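(* Let $\{W(s,t) : s,t\in[0,\infty)\}$ be a standard Wiener field and let $X(s,t):=\mathrm{e}^{-\frac{s}{2}-\frac{t}{2}}\,W(\mathrm{e}^{s},\mathrm{e}^{t})$, $s,t\in\mathbb{R}$, which is a stationary Ornstein-Uhlenbeck field with parameters $(\frac12,\frac12,1)$. Let $S>0$, $T>0$, $\alpha>0$, $\beta>0$. For $s\in(0,S)$ define $$\sqrt{g^{(\alpha)}_S(s)}:=\begin{cases}(S-s)^\alpha\sqrt{\dfrac{S^{1-2\alpha}-(S-s)^{1-2\alpha}}{1-2\alpha}} & \text{if }\alpha\neq\frac12,\\[2mm] \sqrt{(S-s)\ln\!\left(\frac{S}{S-s}\right)} & \text{if }\alpha=\frac12,\end{cases}$$ $$f^{(\alpha)}_S(s):=\begin{cases}\dfrac{S^{2\alpha}}{1-2\alpha}\left(S^{1-2\alpha}-(S-s)^{1-2\alpha}\right) & \text{if }\alpha\neq\frac12,\\[2mm] S\ln\!\left(\frac{S}{S-s}\right) & \text{if }\alpha=\frac12,\end{cases}$$ and define $\sqrt{g^{(\beta)}_T(t)}$ and $f^{(\beta)}_T(t)$ for $t\in(0,T)$ by the same formulas with $\alpha,s,S$ replaced by $\beta,t,T$, respectively. Then the random field $\{U(s,t):(s,t)\in[0,S]\times[0,T]\}$ defined by $$U(s,t):=\begin{cases}\sqrt{g^{(\alpha)}_S(s)\,g^{(\beta)}_T(t)}\;X\!\left(\ln\big(f^{(\alpha)}_S(s)\big),\ln\big(f^{(\beta)}_T(t)\big)\right) & \text{if }(s,t)\in(0,S)\times(0,T),\\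 0 & \text{if } s\in\{0,S\}\text{ or } t\in\{0,T\},\end{cases}$$ is a tied-down scaled Wiener bridge with parameters $(\alpha,\beta)$.
   Context: A random field $\{Y(s,t):(s,t)\in D\}$, $D\subseteq\mathbb{R}^2$, is a Gauss field if all its finite-dimensional distributions are (possibly degenerate) multivariate normal. It has continuous sample paths almost surely if $\mathbb{P}(\{\omega: D\ni(s,t)\mapsto Y(s,t)(\omega)\text{ is continuous}\})=1$. A standard Wiener field is a zero-mean Gauss field $\{W(s,t):s,t\in[0,\infty)\}$ with continuous sample paths almost surely and $\operatorname{Cov}(W(s_1,t_1),W(s_2,t_2))=\min(s_1,s_2)\min(t_1,t_2)$. A stationary Ornstein-Uhlenbeck field with parameters $(\frac12,\frac12,1)$ is a zero-mean Gauss field $\{X(s,t):s,t\in\mathbb{R}\}$ with continuous sample paths almost surely and $\operatorname{Cov}(X(s_1,t_1),X(s_2,t_2))=\exp\{-\frac12|s_2-s_1|-\frac12|t_2-t_1|\}$. For $S>0$, $\alpha>0$ and $s_1,s_2\in[0,S)$ let $$R^{(\alpha)}_S(s_1,s_2)=\begin{cases}\dfrac{(S-s_1)^\alpha(S-s_2)^\alpha}{1-2\alpha}\left(S^{1-2\alpha}-(S-\min(s_1,s_2))^{1-2\alpha}\right) & \text{if }\alpha\neq\frac12,\\[2mm] \sqrt{(S-s_1)(S-s_2)}\,\ln\!\left(\dfrac{S}{S-\min(s_1,s_2)}\right) & \text{if }\alpha=\frac12,\end{cases}$$ and $R^{(\alpha)}_S(s_1,s_2):=0$ if $s_1=S$ or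 $s_2=S$ (this is the covariance function of a scaled Wiener bridge on $[0,S]$ with parameter $\alpha$). $R^{(\beta)}_T$ is defined in the same way on $[0,T]^2$. A tied-down scaled Wiener bridge with parameters $(\alpha,\beta)$ (on $[0,S]\times[0,T]$) is a zero-mean Gauss field $\{X^{(\alpha,\beta)}(s,t):(s,t)\in[0,S]\times[0,T]\}$ with continuous sample paths almost surely and with covariance function $\operatorname{Cov}(X^{(\alpha,\beta)}(s_1,t_1),X^{(\alpha,\beta)}(s_2,t_2))=R^{(\alpha)}_S(s_1,s_2)\,R^{(\beta)}_T(t_1,t_2)$ for $(s_1,t_1),(s_2,t_2)\in[0,S]\times[0,T]$. *)

theory Defs
  imports "HOL-Probability.Probability"
begin

(* Univariate normal law; the point masses are the degenerate (zero variance) case. *)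
definition normal_rv :: "'a measure \<Rightarrow> ('a \<Rightarrow> real) \<Rightarrow> bool" where
  "normal_rv M Z \<longleftrightarrow> Z \<in> borel_measurable M \<and>
     (\<exists>m. (AE \<omega> in M. Z \<omega> = m) \<or> (\<exists>\<sigma>>0. distributed M lborel Z (normal_density m \<sigma>)))"

(* A random vector indexed by a finite set is (possibly degenerate) multivariate normal
   iff all linear combinations of its components are (possibly degenerate) normal. *)
definition multivariate_normal :: "'a measure \<Rightarrow> 'i set \<Rightarrow> ('i \<Rightarrow> 'a \<Rightarrow> real) \<Rightarrow> bool" where
  "multivariate_normal M I Z \<longleftrightarrow> finite I \<and> (\<forall>i\<in>I. Z i \<in> borel_measurable M) \<and>
     (\<forall>c. normal_rv M (\<lambda>\<omega>. \<Sum>i\<in>I. c i * Z i \<omega>))"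

definition covariance :: "'a measure \<Rightarrow> ('a \<Rightarrow> real) \<Rightarrow> ('a \<Rightarrow> real) \<Rightarrow> real" where
  "covariance M Y Z = (\<integral>\<omega>. (Y \<omega> - (\<integral>\<omega>. Y \<omega> \<partial>M)) * (Z \<omega> - (\<integral>\<omega>. Z \<omega> \<partial>M)) \<partial>M)"

(* A random field on D is a total function of which only the values on D matter. *)
type_synonym 'a field = "real \<times> real \<Rightarrow> 'a \<Rightarrow> real"

definition gauss_field :: "'a measure \<Rightarrow> (real \<times> real) set \<Rightarrow> 'a field \<Rightarrow> bool" where
  "gauss_field M D Y \<longleftrightarrow> (\<forall>F. finite F \<longrightarrow> F \<subseteq> D \<longrightarrow> multivariate_normal M F Y)"

(* AE instead of a literal "measure = 1": the set of continuous paths need not be measurable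
   unless M is complete; AE says that it has measure 1 in the completion of M. *)
definition continuous_paths_as :: "'a measure \<Rightarrow> (real \<times> real) set \<Rightarrow> 'a field \<Rightarrow> bool" where
  "continuous_paths_as M D Y \<longleftrightarrow> (AE \<omega> in M. continuous_on D (\<lambda>p. Y p \<omega>))"

definition centred_continuous_gauss_field ::
  "'a measure \<Rightarrow> (real \<times> real) set \<Rightarrow> (real \<times> real \<Rightarrow> real \<times> real \<Rightarrow> real) \<Rightarrow> 'a field \<Rightarrow> bool" where
  "centred_continuous_gauss_field M D K Y \<longleftrightarrow>
     gauss_field M D Y \<and> (\<forall>p\<in>D. (\<integral>\<omega>. Y p \<omega> \<partial>M) = 0) \<and> continuous_paths_as M D Y \<and>
     (\<forall>p\<in>D. \<forall>q\<in>D. covariance M (Y p) (Y q) = K p q)"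

definition standard_wiener_field :: "'a measure \<Rightarrow> 'a field \<Rightarrow> bool" where
  "standard_wiener_field M = centred_continuous_gauss_field M ({0..} \<times> {0..})
     (\<lambda>(s1, t1) (s2, t2). min s1 s2 * min t1 t2)"

(* Stationary Ornstein-Uhlenbeck field with parameters (1/2, 1/2, 1). *)
definition stationary_OU_field :: "'a measure \<Rightarrow> 'a field \<Rightarrow> bool" where
  "stationary_OU_field M = centred_continuous_gauss_field M UNIV
     (\<lambda>(s1, t1) (s2, t2). exp (- (1/2) * \<bar>s2 - s1\<bar> - (1/2) * \<bar>t2 - t1\<bar>))"

definition bridge_cov :: "real \<Rightarrow> real \<Rightarrow> real \<Rightarrow> real \<Rightarrow> real" where
  "bridge_cov \<alpha> S s1 s2 =
     (if s1 = S \<or> s2 = S then 0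
      else if \<alpha> \<noteq> 1/2 then
        (S - s1) powr \<alpha> * (S - s2) powr \<alpha> / (1 - 2 * \<alpha>)
          * (S powr (1 - 2 * \<alpha>) - (S - min s1 s2) powr (1 - 2 * \<alpha>))
      else sqrt ((S - s1) * (S - s2)) * ln (S / (S - min s1 s2)))"

definition tied_down_scaled_wiener_bridge ::
  "'a measure \<Rightarrow> real \<Rightarrow> real \<Rightarrow> real \<Rightarrow> real \<Rightarrow> 'a field \<Rightarrow> bool" where
  "tied_down_scaled_wiener_bridge M S T \<alpha> \<beta> = centred_continuous_gauss_field M ({0..S} \<times> {0..T})
     (\<lambda>(s1, t1) (s2, t2). bridge_cov \<alpha> S s1 s2 * bridge_cov \<beta> T t1 t2)"

definition sqrt_g :: "real \<Rightarrow> real \<Rightarrow> real \<Rightarrow> real" where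
  "sqrt_g \<alpha> S s =
     (if \<alpha> \<noteq> 1/2 then
        (S - s) powr \<alpha> * sqrt ((S powr (1 - 2 * \<alpha>) - (S - s) powr (1 - 2 * \<alpha>)) / (1 - 2 * \<alpha>))
      else sqrt ((S - s) * ln (S / (S - s))))"

definition f_time :: "real \<Rightarrow> real \<Rightarrow> real \<Rightarrow> real" where
  "f_time \<alpha> S s =
     (if \<alpha> \<noteq> 1/2 then
        S powr (2 * \<alpha>) / (1 - 2 * \<alpha>) * (S powr (1 - 2 * \<alpha>) - (S - s) powr (1 - 2 * \<alpha>))
      else S * ln (S / (S - s)))"

end

theory Submission
  imports Defs "HOL-Real_Asymp.Real_Asymp"
begin

text \<open>
In one coordinate, write \<open>f\<close> for \<^const>\<open>f_time\<close> and \<open>a s = ((S - s) / S) powr \<alpha>\<close>. Since \<open>sqrt_g = a * sqrt f\<close>, the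
factors \<open>exp (- ln f / 2)\<close> in the Ornstein-Uhlenbeck field cancel, and in the interior of the
rectangle the field \<open>U\<close> is just a Wiener field that is tapered and run with two clocks,
\<open>U (s, t) = a s * a' t * W (f s, f' t)\<close>, where the primed functions belong to \<open>\<beta>\<close> and \<open>T\<close>. Gaussianity and
mean zero are inherited at once (\<open>centred_continuous_gauss_field_rescale\<close>), and the covariance is
\<open>a s1 * a s2 * f (min s1 s2)\<close> in each coordinate, because the clock is increasing; this is the bridge
covariance (\<open>bridge_cov_eq_taper\<close>). The Ornstein-Uhlenbeck field is treated in the same way.

The substance lies in the continuity of the paths on the edges \<open>s = S\<close> and \<open>t = T\<close>. For \<open>\<alpha> \<ge> 1/2\<close> the clock
tends to infinity there, so that a bound on the growth of the Wiener field at infinity is needed, uniform in the other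
coordinate: for each \<open>\<kappa> > 1/2\<close>, almost surely, the quotient of \<open>W (x, y)\<close> by
\<open>(1 + x) powr \<kappa> * (1 + y) powr \<kappa>\<close> is bounded (\<open>wiener_field_growth\<close>). As a function of the clock the taper is
exponentially small for \<open>\<alpha> = 1/2\<close> and decays with the exponent \<open>\<alpha> / (2 * \<alpha> - 1) > 1/2\<close> for \<open>\<alpha> > 1/2\<close>, so a suitable
\<open>\<kappa>\<close> lies in between, and \<open>U\<close> tends to \<open>0\<close> on these edges (\<open>continuous_on_tapered_sheet\<close>).

The growth bound comes from chaining. A rectangular increment of \<open>W\<close> is centred normal, its variance
is the area of the rectangle, and its fourth moment is three times the square of that. Suitably
weighted, the fourth powers of the increments over all cells of all dyadic grids on all rectangles
\<open>[0, 2 ^ m] \<times> [0, 2 ^ n]\<close> have a finite expected sum; this sum is therefore almost surely finite and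
bounds all increments simultaneously (\<open>wiener_field_dyadic_incr_bound\<close>). Since \<open>W\<close> vanishes on the
axes, values of \<open>W\<close> are sums of such increments along dyadic expansions of both coordinates
(\<open>dyadic_chaining_rect\<close>).\<close>

section \<open>Centred Gaussian fields and their moments\<close>

text \<open>For a centred variable the unknown parameter \<open>m\<close> of \<^const>\<open>normal_rv\<close> is its mean, hence \<open>0\<close>, also in
the degenerate case.\<close>

lemma normal_rv_centred_cases:
  assumes "prob_space M" "normal_rv M Z" "(\<integral>\<omega>. Z \<omega> \<partial>M) = 0"
  obtains "AE \<omega> in M. Z \<omega> = 0"
  | \<sigma> where "0 < \<sigma>" "distributed M lborel Z (normal_density 0 \<sigma>)"
proof -
  interpret prob_space M by fact
  have Z [measurable]: "Z \<in> borel_measurable M"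
    using assms(2) by (simp add: normal_rv_def)
  from assms(2) obtain m where
    "(AE \<omega> in M. Z \<omega> = m) \<or> (\<exists>\<sigma>>0. distributed M lborel Z (normal_density m \<sigma>))"
    unfolding normal_rv_def by blast
  then show thesis
  proof
    assume m: "AE \<omega> in M. Z \<omega> = m"
    then have "(\<integral>\<omega>. Z \<omega> \<partial>M) = (\<integral>\<omega>. m \<partial>M)"
      by (intro integral_cong_AE) auto
    then have "m = 0" using assms(3) by (simp add: prob_space)
    with m that(1) show thesis by simp
  next
    assume "\<exists>\<sigma>>0. distributed M lborel Z (normal_density m \<sigma>)"
    then obtain \<sigma> where \<sigma>: "0 < \<sigma>" "distributed M lborel Z (normal_density m \<sigma>)" by blast
    have "m = 0" using normal_distributed_expectation[OF \<sigma>] assms(3) by simp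
    with \<sigma> that(2) show thesis by simp
  qed
qed

text \<open>Gaussianity enters the path estimates only through the fourth moment: it turns information on
covariances into a bound that is quadratic in the variance, and this extra power is what makes a
union over the cells of a dyadic grid affordable.\<close>

lemma normal_rv_centred_moments:
  assumes M: "prob_space M" and Z: "normal_rv M Z" and Z0: "(\<integral>\<omega>. Z \<omega> \<partial>M) = 0"
  shows integrable_power_normal_rv: "integrable M (\<lambda>\<omega>. Z \<omega> ^ k)"
    and fourth_moment_normal_rv: "(\<integral>\<omega>. Z \<omega> ^ 4 \<partial>M) = 3 * (\<integral>\<omega>. Z \<omega> ^ 2 \<partial>M)\<^sup>2"
proof -
  interpret prob_space M by fact
  have [measurable]: "Z \<in> borel_measurable M"
    using Z by (simp add: normal_rv_def)
  have "integrable M (\<lambda>\<omega>. Z \<omega> ^ k) \<and> (\<integral>\<omega>. Z \<omega> ^ 4 \<partial>M) = 3 * (\<integral>\<omega>. Z \<omega> ^ 2 \<partial>M)\<^sup>2"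
    using M Z Z0
  proof (cases rule: normal_rv_centred_cases)
    case 1
    have "integrable M (\<lambda>\<omega>. Z \<omega> ^ k) \<longleftrightarrow> integrable M (\<lambda>\<omega>. 0 ^ k :: real)"
      using 1 by (intro integrable_cong_AE) auto
    moreover have "(\<integral>\<omega>. Z \<omega> ^ n \<partial>M) = 0" if "n > 0" for n
    proof -
      have "(\<integral>\<omega>. Z \<omega> ^ n \<partial>M) = (\<integral>\<omega>. 0 \<partial>M)"
        using 1 that by (intro integral_cong_AE) (auto simp: power_0_left)
      then show ?thesis by simp
    qed
    ultimately show ?thesis by simp
  next
    case (2 \<sigma>)
    note D = 2(2)
    have "integrable M (\<lambda>\<omega>. Z \<omega> ^ k)"
      using distributed_integrable[OF D, of "\<lambda>x. x ^ k"] integrable_normal_moment[OF 2(1), of 0 k]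
      by simp
    moreover have "(\<integral>\<omega>. Z \<omega> ^ (2 * n) \<partial>M) = fact (2 * n) / ((2 / \<sigma>\<^sup>2) ^ n * fact n)" for n
      using distributed_integral[OF D, of "\<lambda>x. x ^ (2 * n)"]
        integral_normal_moment_even[OF 2(1), of 0 n]
      by simp
    note this[of 1, unfolded mult_1_right] this[of 2]
    then have "(\<integral>\<omega>. Z \<omega> ^ 2 \<partial>M) = \<sigma>\<^sup>2" "(\<integral>\<omega>. Z \<omega> ^ 4 \<partial>M) = 3 * \<sigma> ^ 4"
      by (simp_all add: fact_numeral power_divide field_simps)
    ultimately show ?thesis by (simp flip: power_mult)
  qed
  then show "integrable M (\<lambda>\<omega>. Z \<omega> ^ k)" "(\<integral>\<omega>. Z \<omega> ^ 4 \<partial>M) = 3 * (\<integral>\<omega>. Z \<omega> ^ 2 \<partial>M)\<^sup>2"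
    by blast+
qed

lemma gauss_field_normal_rv:
  assumes "gauss_field M D Y" "p \<in> D"
  shows "normal_rv M (Y p)"
proof -
  have "normal_rv M (\<lambda>\<omega>. \<Sum>i\<in>{p}. 1 * Y i \<omega>)"
    using assms unfolding gauss_field_def multivariate_normal_def
    by (elim allE[of _ "{p}"] impE conjE allE[of _ "\<lambda>_. 1"]) auto
  then show ?thesis by simp
qed

context
  fixes M :: "'a measure" and D :: "(real \<times> real) set" and K and Y :: "'a field"
  assumes M: "prob_space M" and Y: "centred_continuous_gauss_field M D K Y"
begin

interpretation prob_space M by (rule M)

lemma centred_field_gauss: "gauss_field M D Y"
  using Y by (simp add: centred_continuous_gauss_field_def)

lemma centred_field_mean: "p \<in> D \<Longrightarrow> (\<integral>\<omega>. Y p \<omega> \<partial>M) = 0"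
  using Y by (simp add: centred_continuous_gauss_field_def)

lemma centred_field_measurable: "p \<in> D \<Longrightarrow> Y p \<in> borel_measurable M"
  using gauss_field_normal_rv[OF centred_field_gauss] by (simp add: normal_rv_def)

lemma centred_field_integrable_power: "p \<in> D \<Longrightarrow> integrable M (\<lambda>\<omega>. Y p \<omega> ^ k)"
  by (intro integrable_power_normal_rv M gauss_field_normal_rv[OF centred_field_gauss]
      centred_field_mean)

lemma centred_field_integrable: "p \<in> D \<Longrightarrow> integrable M (Y p)"
  using centred_field_integrable_power[of p 1] by simp

lemma centred_field_integrable_mult:
  assumes "p \<in> D" "q \<in> D"
  shows "integrable M (\<lambda>\<omega>. Y p \<omega> * Y q \<omega>)"
proof (rule Bochner_Integration.integrable_bound)
  show "integrable M (\<lambda>\<omega>. Y p \<omega> ^ 2 + Y q \<omega> ^ 2)"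
    using assms by (intro Bochner_Integration.integrable_add centred_field_integrable_power)
  show "(\<lambda>\<omega>. Y p \<omega> * Y q \<omega>) \<in> borel_measurable M"
    using assms centred_field_measurable by (intro borel_measurable_times)
  have "norm (a * b) \<le> norm (a ^ 2 + b ^ 2)" for a b :: real
    using sum_squares_bound[of a b] sum_squares_bound[of a "- b"]
      zero_le_power2[of a] zero_le_power2[of b]
    unfolding real_norm_def power2_minus mult_minus_right mult.assoc by linarith
  then show "AE \<omega> in M. norm (Y p \<omega> * Y q \<omega>) \<le> norm (Y p \<omega> ^ 2 + Y q \<omega> ^ 2)"
    by (intro always_eventually allI)
qed

lemma centred_field_covariance:
  assumes "p \<in> D" "q \<in> D"
  shows "(\<integral>\<omega>. Y p \<omega> * Y q \<omega> \<partial>M) = K p q"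
  using assms Y centred_field_mean
  by (simp add: centred_continuous_gauss_field_def covariance_def)

lemma centred_field_sum_normal:
  assumes "finite F" "F \<subseteq> D"
  shows "normal_rv M (\<lambda>\<omega>. \<Sum>p\<in>F. c p * Y p \<omega>)"
  using centred_field_gauss assms unfolding gauss_field_def multivariate_normal_def by blast

lemma centred_field_sum_mean:
  assumes "F \<subseteq> D"
  shows "(\<integral>\<omega>. (\<Sum>p\<in>F. c p * Y p \<omega>) \<partial>M) = 0"
proof -
  have "(\<integral>\<omega>. (\<Sum>p\<in>F. c p * Y p \<omega>) \<partial>M) = (\<Sum>p\<in>F. \<integral>\<omega>. c p * Y p \<omega> \<partial>M)"
    using assms by (intro Bochner_Integration.integral_sum integrable_mult_right
        centred_field_integrable) (rule subsetD)
  also have "\<dots> = 0"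
    using assms by (intro sum.neutral ballI) (simp add: centred_field_mean subsetD)
  finally show ?thesis .
qed

lemma centred_field_sum_variance:
  assumes "F \<subseteq> D"
  shows "(\<integral>\<omega>. (\<Sum>p\<in>F. c p * Y p \<omega>)\<^sup>2 \<partial>M) = (\<Sum>p\<in>F. \<Sum>q\<in>F. c p * c q * K p q)"
proof -
  have "(\<Sum>p\<in>F. c p * Y p \<omega>)\<^sup>2 = (\<Sum>p\<in>F. \<Sum>q\<in>F. (c p * c q) * (Y p \<omega> * Y q \<omega>))" for \<omega>
    by (simp add: power2_eq_square sum_product mult_ac)
  then have "(\<integral>\<omega>. (\<Sum>p\<in>F. c p * Y p \<omega>)\<^sup>2 \<partial>M) =
      (\<integral>\<omega>. (\<Sum>p\<in>F. \<Sum>q\<in>F. (c p * c q) * (Y p \<omega> * Y q \<omega>)) \<partial>M)" by simp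
  also have "\<dots> = (\<Sum>p\<in>F. \<Sum>q\<in>F. \<integral>\<omega>. (c p * c q) * (Y p \<omega> * Y q \<omega>) \<partial>M)"
    using assms
    by (subst Bochner_Integration.integral_sum Bochner_Integration.integrable_sum;
        intro sum.cong refl Bochner_Integration.integral_sum Bochner_Integration.integrable_sum
          integrable_mult_right centred_field_integrable_mult; blast)
  also have "\<dots> = (\<Sum>p\<in>F. \<Sum>q\<in>F. c p * c q * K p q)"
    using assms by (intro sum.cong refl) (simp add: centred_field_covariance subsetD)
  finally show ?thesis .
qed

lemma gauss_field_rescale:
  assumes \<phi>: "\<And>p. p \<in> D' \<Longrightarrow> \<phi> p \<in> D"
    and Y': "\<And>p \<omega>. p \<in> D' \<Longrightarrow> Y' p \<omega> = a p * Y (\<phi> p) \<omega>"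
  shows "gauss_field M D' Y'"
  unfolding gauss_field_def multivariate_normal_def
proof (intro allI impI conjI ballI)
  fix F c assume F: "finite F" "F \<subseteq> D'"
  \<comment> \<open>Points with the same image under \<open>\<phi>\<close> are grouped, because \<open>\<phi>\<close> need not be injective.\<close>
  have "(\<Sum>p\<in>F. c p * Y' p \<omega>) = (\<Sum>q\<in>\<phi> ` F. (\<Sum>p\<in>{p\<in>F. \<phi> p = q}. c p * a p) * Y q \<omega>)" for \<omega>
  proof -
    have "(\<Sum>p\<in>F. c p * Y' p \<omega>) = (\<Sum>q\<in>\<phi> ` F. \<Sum>p\<in>{p\<in>F. \<phi> p = q}. c p * Y' p \<omega>)"
      using F(1) by (rule sum.image_gen)
    also have "\<dots> = (\<Sum>q\<in>\<phi> ` F. (\<Sum>p\<in>{p\<in>F. \<phi> p = q}. c p * a p) * Y q \<omega>)"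
      using F(2) Y' by (auto intro!: sum.cong simp: sum_distrib_right subset_iff)
    finally show ?thesis .
  qed
  moreover have "normal_rv M (\<lambda>\<omega>. \<Sum>q\<in>\<phi> ` F. (\<Sum>p\<in>{p\<in>F. \<phi> p = q}. c p * a p) * Y q \<omega>)"
    using F \<phi> by (intro centred_field_sum_normal) auto
  ultimately show "normal_rv M (\<lambda>\<omega>. \<Sum>p\<in>F. c p * Y' p \<omega>)" by simp
next
  fix F p assume "F \<subseteq> D'" "p \<in> F"
  then have p: "p \<in> D'" by blast
  then have "Y' p = (\<lambda>\<omega>. a p * Y (\<phi> p) \<omega>)" by (intro ext Y')
  with p \<phi> centred_field_measurable show "Y' p \<in> borel_measurable M" by auto
qed auto

text \<open>Both fields of the theorem arise from the Wiener field by evaluating it along a map \<open>\<phi>\<close> and multiplying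
with a deterministic factor, which leaves only the covariance identity and the continuity of the
paths to be checked in each case.\<close>

lemma centred_continuous_gauss_field_rescale:
  assumes \<phi>: "\<And>p. p \<in> D' \<Longrightarrow> \<phi> p \<in> D"
    and Y': "\<And>p \<omega>. p \<in> D' \<Longrightarrow> Y' p \<omega> = a p * Y (\<phi> p) \<omega>"
    and K': "\<And>p q. p \<in> D' \<Longrightarrow> q \<in> D' \<Longrightarrow> K' p q = a p * a q * K (\<phi> p) (\<phi> q)"
    and cont: "continuous_paths_as M D' Y'"
  shows "centred_continuous_gauss_field M D' K' Y'"
proof -
  have mean: "(\<integral>\<omega>. Y' p \<omega> \<partial>M) = 0" if "p \<in> D'" for p
    using that Y' \<phi> centred_field_mean by simp
  have "covariance M (Y' p) (Y' q) = K' p q" if "p \<in> D'" "q \<in> D'" for p q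
  proof -
    have "covariance M (Y' p) (Y' q) = (\<integral>\<omega>. a p * a q * (Y (\<phi> p) \<omega> * Y (\<phi> q) \<omega>) \<partial>M)"
      unfolding covariance_def mean[OF that(1)] mean[OF that(2)]
      by (simp add: Y'[OF that(1)] Y'[OF that(2)] mult_ac)
    also have "\<dots> = K' p q"
      using that \<phi> K' centred_field_covariance by simp
    finally show ?thesis .
  qed
  with mean cont gauss_field_rescale[OF \<phi> Y'] show ?thesis
    by (simp add: centred_continuous_gauss_field_def)
qed

end

section \<open>Dyadic chaining in the plane\<close>

text \<open>A dyadic point of level \<open>K\<close> is reached from \<open>0\<close> with at most one step of each length
\<open>L / 2 ^ k\<close>, \<open>k \<le> K\<close>: its last step leads back to a dyadic point of level \<open>K - 1\<close>. The steps add up to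
at most a geometric series, and continuity extends the bound to all points.\<close>

lemma dyadic_chaining:
  fixes v :: "real \<Rightarrow> real"
  assumes cont: "continuous_on {0..L} v" and v0: "v 0 = 0"
    and r: "0 \<le> r" "r < 1" and A: "0 \<le> A"
    and incr: "\<And>k i. i < 2 ^ k \<Longrightarrow> \<bar>v (L * real (Suc i) / 2 ^ k) - v (L * real i / 2 ^ k)\<bar> \<le> A * r ^ k"
    and x: "x \<in> {0..L}"
  shows "\<bar>v x\<bar> \<le> A / (1 - r)"
proof (cases "L = 0")
  case True
  then show ?thesis using x v0 r A by simp
next
  case False
  then have L: "L > 0" using x by simp
  have dyadic: "\<bar>v (L * real j / 2 ^ K)\<bar> \<le> A * (\<Sum>k\<le>K. r ^ k)" if "j \<le> 2 ^ K" for j K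
    using that
  proof (induction K arbitrary: j)
    case 0
    then have "j = 0 \<or> j = 1" by auto
    then show ?case using v0 incr[of 0 0] A by auto
  next
    case (Suc K)
    have even: "\<bar>v (L * real (2 * i) / 2 ^ Suc K)\<bar> \<le> A * (\<Sum>k\<le>K. r ^ k)" if "i \<le> 2 ^ K" for i
      using Suc.IH[OF that] by (simp add: field_simps)
    have mono: "A * (\<Sum>k\<le>K. r ^ k) + A * r ^ Suc K = A * (\<Sum>k\<le>Suc K. r ^ k)"
      by (simp add: distrib_left)
    have nn: "0 \<le> A * r ^ Suc K" using A r by simp
    show ?case
    proof (cases "even j")
      case True
      then obtain i where i: "j = 2 * i" by blast
      then have "i \<le> 2 ^ K" using Suc.prems by simp
      from even[OF this] mono nn show ?thesis unfolding i by linarith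
    next
      case False
      then obtain i where i: "j = Suc (2 * i)" by (metis oddE Suc_eq_plus1)
      then have *: "2 * i < 2 ^ Suc K" "i \<le> 2 ^ K" using Suc.prems by simp_all
      from even[OF *(2)] incr[OF *(1)] mono show ?thesis unfolding i by linarith
    qed
  qed
  have geom: "A * (\<Sum>k\<le>K. r ^ k) \<le> A / (1 - r)" for K
  proof -
    have "(\<Sum>k\<le>K. r ^ k) \<le> (\<Sum>k. r ^ k)"
      using r by (intro sum_le_suminf summable_geometric) auto
    also have "\<dots> = 1 / (1 - r)" using r by (intro suminf_geometric) auto
    finally show ?thesis using A by (auto dest: mult_left_mono[of _ _ A])
  qed
  \<comment> \<open>The dyadic approximations of \<open>x\<close> from below.\<close>
  define j where "j K = nat \<lfloor>x / L * 2 ^ K\<rfloor>" for K :: nat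
  define y where "y K = L * real (j K) / 2 ^ K" for K
  have xL: "0 \<le> x / L" "x / L \<le> 1" using x L by auto
  have j: "real (j K) \<le> x / L * 2 ^ K" "x / L * 2 ^ K < real (j K) + 1" for K
    
    using mult_nonneg_nonneg[OF xL(1), of "2 ^ K"] unfolding j_def
    by (simp_all only: of_nat_nat zero_le_floor zero_le_power zero_le_numeral) linarith+
  have jK: "j K \<le> 2 ^ K" for K
  proof -
    have "real (j K) \<le> real (2 ^ K)"
      using order_trans[OF j(1)[of K] mult_right_mono[OF xL(2), of "2 ^ K"]] by simp
    then show ?thesis by (simp only: of_nat_le_iff)
  qed
  have yb: "y K \<le> x" "x - L * (1/2) ^ K \<le> y K" for K
  proof -
    have *: "L * real (j K) \<le> x * 2 ^ K" "x * 2 ^ K \<le> L + L * real (j K)"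
      using j[of K] L by (simp_all add: field_simps)
    from *(1) show "y K \<le> x" unfolding y_def by (simp add: pos_divide_le_eq)
    from *(2) have "x \<le> (L + L * real (j K)) / 2 ^ K" by (simp add: pos_le_divide_eq)
    then show "x - L * (1/2) ^ K \<le> y K"
      unfolding y_def by (simp add: add_divide_distrib power_divide)
  qed
  have y0: "0 \<le> y K" for K using L by (simp add: y_def)
  have "(\<lambda>K. x - L * (1/2) ^ K) \<longlonglongrightarrow> x - L * 0"
    by (intro tendsto_intros LIMSEQ_power_zero) auto
  then have "y \<longlonglongrightarrow> x"
    by (intro tendsto_sandwich[of "\<lambda>K. x - L * (1/2) ^ K" y _ "\<lambda>_. x"]) (use yb in auto)
  then have "(\<lambda>K. v (y K)) \<longlonglongrightarrow> v x"
    using x yb(1) y0 by (intro continuous_on_tendsto_compose[OF cont])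
      (auto intro!: always_eventually intro: order_trans)
  then have "(\<lambda>K. \<bar>v (y K)\<bar>) \<longlonglongrightarrow> \<bar>v x\<bar>" by (rule tendsto_rabs)
  then show ?thesis
    using order_trans[OF dyadic[OF jK] geom] unfolding y_def
    by (intro LIMSEQ_le_const2[of _ "\<bar>v x\<bar>"]) auto
qed

definition rect_incr :: "(real \<times> real \<Rightarrow> real) \<Rightarrow> real \<Rightarrow> real \<Rightarrow> real \<Rightarrow> real \<Rightarrow> real" where
  "rect_incr w a b c d = w (b, d) - w (a, d) - w (b, c) + w (a, c)"

text \<open>Two-parameter chaining is one-parameter chaining applied twice, first in the second variable to the
difference of two columns, then in the first variable. Only rectangular increments
are needed, since the function vanishes on the axes; this matters because the variance of a
rectangular increment of the Wiener field is the area of the rectangle, small in both directions.\<close>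

lemma dyadic_chaining_rect:
  fixes w :: "real \<times> real \<Rightarrow> real"
  assumes cont: "continuous_on ({0..L} \<times> {0..L'}) w"
    and w0: "\<And>y. y \<in> {0..L'} \<Longrightarrow> w (0, y) = 0" "\<And>x. x \<in> {0..L} \<Longrightarrow> w (x, 0) = 0"
    and r: "0 \<le> r" "r < 1" and A: "0 \<le> A"
    and incr: "\<And>k l i j. i < 2 ^ k \<Longrightarrow> j < 2 ^ l \<Longrightarrow>
      \<bar>rect_incr w (L * real i / 2 ^ k) (L * real (Suc i) / 2 ^ k)
         (L' * real j / 2 ^ l) (L' * real (Suc j) / 2 ^ l)\<bar> \<le> A * r ^ k * r ^ l"
    and x: "x \<in> {0..L}" and y: "y \<in> {0..L'}"
  shows "\<bar>w (x, y)\<bar> \<le> A / (1 - r) / (1 - r)"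
proof (rule dyadic_chaining[where v = "\<lambda>x. w (x, y)"])
  have L: "0 \<le> L" "0 \<le> L'" using x y by auto
  show "continuous_on {0..L} (\<lambda>x. w (x, y))"
    using y by (intro continuous_on_compose2[OF cont] continuous_intros) auto
  fix k i :: nat assume i: "i < 2 ^ k"
  let ?a = "L * real i / 2 ^ k" and ?b = "L * real (Suc i) / 2 ^ k"
  have le: "L * real n / 2 ^ k \<in> {0..L}" if "n \<le> 2 ^ k" for n
  proof -
    have "real n \<le> 2 ^ k" using that of_nat_le_iff[where 'a=real, of n "2 ^ k"] by simp
    then have "L * (real n / 2 ^ k) \<le> L * 1" using L by (intro mult_left_mono) auto
    then show ?thesis using L by simp
  qed
  have ab: "?a \<in> {0..L}" "?b \<in> {0..L}" using i le[of i] le[of "Suc i"] by auto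
  have "\<bar>w (?b, y) - w (?a, y)\<bar> \<le> (A * r ^ k) / (1 - r)"
  proof (rule dyadic_chaining[where v = "\<lambda>y. w (?b, y) - w (?a, y)"])
    show "continuous_on {0..L'} (\<lambda>y. w (?b, y) - w (?a, y))"
      using ab by (intro continuous_on_diff continuous_on_compose2[OF cont] continuous_intros) auto
  next
    fix l j :: nat assume "j < 2 ^ l"
    from incr[OF i this] show
      "\<bar>w (?b, L' * real (Suc j) / 2 ^ l) - w (?a, L' * real (Suc j) / 2 ^ l) -
        (w (?b, L' * real j / 2 ^ l) - w (?a, L' * real j / 2 ^ l))\<bar> \<le> A * r ^ k * r ^ l"
      by (simp add: rect_incr_def algebra_simps)
  qed (use r A y ab w0 in auto)
  then show "\<bar>w (?b, y) - w (?a, y)\<bar> \<le> A / (1 - r) * r ^ k" by simp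
qed (use assms in auto)

section \<open>Growth of the Wiener field at infinity\<close>

lemma wiener_field_rect_incr_normal:
  assumes M: "prob_space M" and W: "standard_wiener_field M W"
    and ab: "0 \<le> a" "a < b" and cd: "0 \<le> c" "c < d"
  defines "R \<equiv> \<lambda>\<omega>. rect_incr (\<lambda>p. W p \<omega>) a b c d"
  shows "normal_rv M R" and "(\<integral>\<omega>. R \<omega> \<partial>M) = 0" and "(\<integral>\<omega>. R \<omega> ^ 2 \<partial>M) = (b - a) * (d - c)"
proof -
  \<comment> \<open>Since \<open>a < b\<close> and \<open>c < d\<close>, the four corners are distinct, so that a sum over a set represents the increment.\<close>
  define F where "F = {(b, d), (a, d), (b, c), (a, c)}"
  define e :: "real \<times> real \<Rightarrow> real" where "e p = (if p = (b, d) \<or> p = (a, c) then 1 else - 1)" for p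
  have F: "finite F" "F \<subseteq> {0..} \<times> {0..}" using ab cd by (auto simp: F_def)
  have R: "R = (\<lambda>\<omega>. \<Sum>p\<in>F. e p * W p \<omega>)"
    using ab cd by (auto simp: R_def F_def e_def rect_incr_def)
  note W' = W[unfolded standard_wiener_field_def]
  show "normal_rv M R" "(\<integral>\<omega>. R \<omega> \<partial>M) = 0"
    unfolding R using F centred_field_sum_normal[OF M W'] centred_field_sum_mean[OF M W'] by auto
  show "(\<integral>\<omega>. R \<omega> ^ 2 \<partial>M) = (b - a) * (d - c)"
    unfolding R centred_field_sum_variance[OF M W' F(2)]
    using ab cd by (simp add: F_def e_def min_def algebra_simps)
qed

text \<open>At each fixed point of the axes the variance is \<open>0\<close>. The exceptional null sets can be united over the
rational points, and continuity of the paths takes care of the others.\<close>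

lemma wiener_field_axes_zero:
  assumes M: "prob_space M" and W: "standard_wiener_field M W"
  shows "AE \<omega> in M. \<forall>x\<ge>0. W (x, 0) \<omega> = 0 \<and> W (0, x) \<omega> = 0"
proof -
  note W' = W[unfolded standard_wiener_field_def]
  have null: "AE \<omega> in M. W p \<omega> = 0" if p: "p \<in> {0..} \<times> {0..}" "fst p = 0 \<or> snd p = 0" for p
  proof -
    have "(\<integral>\<omega>. W p \<omega> ^ 2 \<partial>M) = 0"
      using centred_field_covariance[OF M W' p(1) p(1)] p
      by (auto simp: power2_eq_square split: prod.splits)
    then have "AE \<omega> in M. W p \<omega> ^ 2 = 0"
      using integral_nonneg_eq_0_iff_AE[OF centred_field_integrable_power[OF M W' p(1), of 2]]
      by simp
    then show ?thesis by simp
  qed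
  have "AE \<omega> in M. \<forall>q\<in>\<rat> \<inter> {0..}. W (q, 0) \<omega> = 0 \<and> W (0, q) \<omega> = 0"
    using null by (intro AE_ball_countable[THEN iffD2] ballI AE_conjI)
      (auto intro: countable_rat countable_Int1)
  moreover have "AE \<omega> in M. continuous_on ({0..} \<times> {0..}) (\<lambda>p. W p \<omega>)"
    using W' by (simp add: centred_continuous_gauss_field_def continuous_paths_as_def)
  ultimately show ?thesis
  proof eventually_elim
    case (elim \<omega>)
    have dense: "closure (\<rat> \<inter> {0..}) = {0::real..}"
    proof
      show "closure (\<rat> \<inter> {0..}) \<subseteq> {0::real..}" by (intro closure_minimal) auto
      have "{0::real<..} \<subseteq> closure ({0<..} \<inter> \<rat>)"
        using open_Int_closure_subset[of "{0::real<..}" \<rat>] by (simp add: Rats_closure_real)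
      also have "\<dots> \<subseteq> closure (\<rat> \<inter> {0..})" by (intro closure_mono) force
      finally have "closure {0::real<..} \<subseteq> closure (\<rat> \<inter> {0..})"
        by (intro closure_minimal closed_closure)
      then show "{0::real..} \<subseteq> closure (\<rat> \<inter> {0..})" by simp
    qed
    have "W (x, 0) \<omega> = 0" if "x \<ge> 0" for x
      by (rule continuous_constant_on_closure[of "\<rat> \<inter> {0..}" "\<lambda>x. W (x, 0) \<omega>"])
        (use elim that in \<open>auto simp: dense intro!: continuous_on_compose2[OF elim(2)] continuous_intros\<close>)
    moreover have "W (0, x) \<omega> = 0" if "x \<ge> 0" for x
      by (rule continuous_constant_on_closure[of "\<rat> \<inter> {0..}" "\<lambda>x. W (0, x) \<omega>"])
        (use elim that in \<open>auto simp: dense intro!: continuous_on_compose2[OF elim(2)] continuous_intros\<close>)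
    ultimately show ?case by blast
  qed
qed

text \<open>The increment over the cell \<open>(i, j)\<close> of the grid that divides \<open>[0, 2 ^ m] \<times> [0, 2 ^ n]\<close> into
\<open>2 ^ k \<times> 2 ^ l\<close> equal cells. The indices \<open>m\<close>, \<open>n\<close> measure the growth at infinity and \<open>k\<close>, \<open>l\<close> the
regularity at small scales.\<close>

definition dyadic_rect_incr :: "(real \<times> real \<Rightarrow> real) \<Rightarrow> nat \<Rightarrow> nat \<Rightarrow> nat \<Rightarrow> nat \<Rightarrow> nat \<Rightarrow> nat \<Rightarrow> real" where
  "dyadic_rect_incr w m n k l i j =
     rect_incr w (2 ^ m * real i / 2 ^ k) (2 ^ m * real (Suc i) / 2 ^ k)
       (2 ^ n * real j / 2 ^ l) (2 ^ n * real (Suc j) / 2 ^ l)"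

lemma suminf_geometric_ennreal_less_top:
  fixes q :: real
  assumes "0 \<le> q" "q < 1"
  shows "(\<Sum>n. ennreal (q ^ n)) < \<top>"
proof -
  have "(\<Sum>n. ennreal (q ^ n)) = ennreal (1 / (1 - q))"
    using assms by (intro suminf_ennreal_eq geometric_sums) auto
  then show ?thesis by simp
qed

text \<open>One random variable controls all increments simultaneously. A cell has area
\<open>2 ^ (m + n - k - l)\<close>, so its fourth moment is three times the square of this, and the \<open>2 ^ (k + l)\<close>
cells of one grid together contribute a multiple of \<open>4 ^ (m + n) / 2 ^ (k + l)\<close>. After division by the
fourth power of \<open>c ^ (m + n) * r ^ (k + l)\<close> the expectations form convergent geometric series in all
four indices, exactly because \<open>4 < c ^ 4\<close> and \<open>1 < 2 * r ^ 4\<close>. The sum \<open>Z\<close> of all normalised fourth powers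
is therefore almost surely finite, and it dominates each of its terms, so it plays the role of a maximal
inequality.\<close>

lemma wiener_field_dyadic_incr_bound:
  fixes c r :: real
  assumes M: "prob_space M" and W: "standard_wiener_field M W"
    and c: "0 < c" "4 < c ^ 4" and r: "0 < r" "1 < 2 * r ^ 4"
  shows "AE \<omega> in M. \<exists>C\<ge>0. \<forall>m n k l. \<forall>i<2^k. \<forall>j<2^l.
    \<bar>dyadic_rect_incr (\<lambda>p. W p \<omega>) m n k l i j\<bar> \<le> C * c ^ m * c ^ n * r ^ k * r ^ l"
proof -
  define g where "g m n k l i j \<omega> =
    ennreal ((dyadic_rect_incr (\<lambda>p. W p \<omega>) m n k l i j / (c ^ m * c ^ n * r ^ k * r ^ l)) ^ 4)"
    for m n k l i j \<omega>
  define h where "h m n k l \<omega> = (\<Sum>i<2^k. \<Sum>j<2^l. g m n k l i j \<omega>)" for m n k l \<omega>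
  define Z where "Z \<omega> = (\<Sum>m. \<Sum>n. \<Sum>k. \<Sum>l. h m n k l \<omega>)" for \<omega>
  define q p where "q = 4 / c ^ 4" and "p = 1 / (2 * r ^ 4)"
  have g: "g m n k l i j \<in> borel_measurable M"
    "(\<integral>\<^sup>+\<omega>. g m n k l i j \<omega> \<partial>M) = ennreal (3 * q ^ m * q ^ n * p ^ k * p ^ l / (2 ^ k * 2 ^ l))" for m n k l i j
  proof -
    define R where "R \<omega> = dyadic_rect_incr (\<lambda>p. W p \<omega>) m n k l i j" for \<omega>
    define N where "N = c ^ m * c ^ n * r ^ k * r ^ l"
    have lt: "2 ^ m * real i / 2 ^ k < 2 ^ m * real (Suc i) / 2 ^ k" for m k i :: nat
      by (intro divide_strict_right_mono mult_strict_left_mono) auto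
    have R: "normal_rv M R" "(\<integral>\<omega>. R \<omega> \<partial>M) = 0" "(\<integral>\<omega>. R \<omega> ^ 2 \<partial>M) = 2 ^ m / 2 ^ k * (2 ^ n / 2 ^ l)"
      using wiener_field_rect_incr_normal[OF M W _ lt[of m i k] _ lt[of n j l]]
      unfolding R_def dyadic_rect_incr_def
      by (simp_all add: algebra_simps flip: diff_divide_distrib)
    have [measurable]: "R \<in> borel_measurable M" using R(1) by (simp add: normal_rv_def)
    have geq: "g m n k l i j = (\<lambda>\<omega>. ennreal ((R \<omega> / N) ^ 4))"
      by (simp add: fun_eq_iff g_def R_def N_def)
    show "g m n k l i j \<in> borel_measurable M" unfolding geq by measurable
    have int: "integrable M (\<lambda>\<omega>. (R \<omega> / N) ^ 4)"
      unfolding power_divide by (intro integrable_divide integrable_power_normal_rv[OF M R(1,2)])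
    have "(\<integral>\<^sup>+\<omega>. g m n k l i j \<omega> \<partial>M) = ennreal (\<integral>\<omega>. (R \<omega> / N) ^ 4 \<partial>M)"
      unfolding geq by (intro nn_integral_eq_integral int) auto
    also have "(\<integral>\<omega>. (R \<omega> / N) ^ 4 \<partial>M) = 3 * (2 ^ m / 2 ^ k * (2 ^ n / 2 ^ l))\<^sup>2 / N ^ 4"
      unfolding power_divide by (simp add: fourth_moment_normal_rv[OF M R(1,2)] R(3))
    also have "\<dots> = 3 * q ^ m * q ^ n * p ^ k * p ^ l / (2 ^ k * 2 ^ l)"
    proof -
      have pw: "(x ^ y) ^ z = (x ^ z) ^ y" for x :: real and y z by (simp flip: power_mult add: mult.commute)
      have 4: "(2 ^ y)\<^sup>2 = (4::real) ^ y" "(4::real) ^ y = 2 ^ y * 2 ^ y" for y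
        by (simp_all add: pw[of 2 y 2] flip: power_mult_distrib)
      show ?thesis using c r
        by (simp add: N_def q_def p_def power_mult_distrib power_divide pw[of c _ 4] pw[of r _ 4] 4(1))
           (simp add: 4(2) field_simps)
    qed
    finally show "(\<integral>\<^sup>+\<omega>. g m n k l i j \<omega> \<partial>M) =
      ennreal (3 * q ^ m * q ^ n * p ^ k * p ^ l / (2 ^ k * 2 ^ l))" .
  qed
  note [measurable] = g(1)
  have pq: "0 \<le> q" "q < 1" "0 \<le> p" "p < 1" using c r by (auto simp: q_def p_def)
  have h_meas [measurable]: "h m n k l \<in> borel_measurable M" for m n k l unfolding h_def by measurable
  have h_int: "(\<integral>\<^sup>+\<omega>. h m n k l \<omega> \<partial>M) = 3 * ennreal (q ^ m) * ennreal (q ^ n) * ennreal (p ^ k) * ennreal (p ^ l)" for m n k l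
  proof -
    have "(\<integral>\<^sup>+\<omega>. h m n k l \<omega> \<partial>M) =
      (\<Sum>i<(2::nat)^k. \<Sum>j<(2::nat)^l. ennreal (3 * q ^ m * q ^ n * p ^ k * p ^ l / (2 ^ k * 2 ^ l)))"
      unfolding h_def by (simp add: nn_integral_sum g(2))
    also have "\<dots> = ennreal (\<Sum>i<(2::nat)^k. \<Sum>j<(2::nat)^l. 3 * q ^ m * q ^ n * p ^ k * p ^ l / (2 ^ k * 2 ^ l))"
      using pq by (simp add: sum_ennreal sum_nonneg del: sum_constant)
    also have "(\<Sum>i<(2::nat)^k. \<Sum>j<(2::nat)^l. 3 * q ^ m * q ^ n * p ^ k * p ^ l / (2 ^ k * 2 ^ l)) =
      3 * q ^ m * q ^ n * p ^ k * p ^ l" by simp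
    finally show ?thesis using pq by (simp add: ennreal_mult)
  qed
  have Z_meas: "Z \<in> borel_measurable M" unfolding Z_def by measurable
  have "(\<integral>\<^sup>+\<omega>. Z \<omega> \<partial>M) =
    (\<Sum>m. \<Sum>n. \<Sum>k. \<Sum>l. 3 * ennreal (q ^ m) * ennreal (q ^ n) * ennreal (p ^ k) * ennreal (p ^ l))"
    unfolding Z_def by (simp add: nn_integral_suminf h_int del: ennreal_suminf_cmult)
  also have "\<dots> = 3 * (\<Sum>m. ennreal (q ^ m)) * (\<Sum>m. ennreal (q ^ m)) * (\<Sum>m. ennreal (p ^ m)) * (\<Sum>m. ennreal (p ^ m))"
    by simp
  also have "\<dots> < \<top>"
    using suminf_geometric_ennreal_less_top[OF pq(1,2)] suminf_geometric_ennreal_less_top[OF pq(3,4)]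
    by (simp add: ennreal_mult_less_top)
  finally have "AE \<omega> in M. Z \<omega> \<noteq> \<infinity>"
    by (intro nn_integral_noteq_infinite Z_meas) auto
  then show ?thesis
  proof eventually_elim
    case (elim \<omega>)
    define z where "z = enn2real (Z \<omega>)"
    have z: "Z \<omega> = ennreal z" "0 \<le> z" using elim by (auto simp: z_def less_top)
    have term_le: "f i \<le> suminf f" for f :: "nat \<Rightarrow> ennreal" and i
      using ennreal_suminf_lessD[of f "f i" i] by (meson not_le less_irrefl)
    have "\<bar>dyadic_rect_incr (\<lambda>p. W p \<omega>) m n k l i j\<bar> \<le> root 4 z * c ^ m * c ^ n * r ^ k * r ^ l"
      if "i < 2 ^ k" "j < 2 ^ l" for m n k l i j
    proof -
      define N where "N = c ^ m * c ^ n * r ^ k * r ^ l"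
      define \<rho> where "\<rho> = dyadic_rect_incr (\<lambda>p. W p \<omega>) m n k l i j"
      have N: "N > 0" using c r by (simp add: N_def)
      have "g m n k l i j \<omega> \<le> (\<Sum>j<2^l. g m n k l i j \<omega>)"
        using that by (intro member_le_sum) auto
      also have "\<dots> \<le> h m n k l \<omega>"
        unfolding h_def using that by (intro member_le_sum[of i "{..<2^k}" "\<lambda>i. \<Sum>j<2^l. g m n k l i j \<omega>"]) auto
      also have "\<dots> \<le> (\<Sum>l. h m n k l \<omega>)" by (rule term_le)
      also have "\<dots> \<le> (\<Sum>k. \<Sum>l. h m n k l \<omega>)" by (rule term_le)
      also have "\<dots> \<le> (\<Sum>n. \<Sum>k. \<Sum>l. h m n k l \<omega>)" by (rule term_le)
      also have "\<dots> \<le> Z \<omega>" unfolding Z_def by (rule term_le)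
      finally have "(\<rho> / N) ^ 4 \<le> z"
        using z by (simp add: g_def \<rho>_def N_def)
      then have "root 4 (\<bar>\<rho> / N\<bar> ^ 4) \<le> root 4 z"
        by (intro real_root_le_mono) (simp_all only: power_even_abs even_numeral zero_less_numeral)
      then have "\<bar>\<rho> / N\<bar> \<le> root 4 z" by (subst (asm) real_root_power_cancel) auto
      then have "\<bar>\<rho>\<bar> \<le> root 4 z * N" using N by (simp add: field_simps)
      then show ?thesis by (simp add: \<rho>_def N_def mult_ac)
    qed
    moreover have "0 \<le> root 4 z" using z by simp
    ultimately show ?case by blast
  qed
qed

lemma exists_dyadic_bracket:
  fixes x :: real
  assumes "0 \<le> x"
  obtains m :: nat where "x \<le> 2 ^ m" "2 ^ m \<le> 2 * (1 + x)"
proof -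
  define m where "m = (LEAST m::nat. x \<le> 2 ^ m)"
  obtain m0 :: nat where "x < 2 ^ m0" using real_arch_pow[of 2 x] by auto
  then have m: "x \<le> 2 ^ m" unfolding m_def by (intro LeastI[of "\<lambda>m. x \<le> 2 ^ m" m0] less_imp_le)
  moreover have "2 ^ m \<le> 2 * (1 + x)"
  proof (cases m)
    case (Suc m')
    then have "\<not> x \<le> 2 ^ m'" unfolding m_def by (metis lessI not_less_Least)
    then show ?thesis using Suc by simp
  qed (use assms in simp)
  ultimately show thesis using that by blast
qed

text \<open>The standard deviation of \<open>W (x, y)\<close> is \<open>sqrt (x * y)\<close>, and any exponent larger than \<open>1/2\<close> suffices to bound
the whole path. Lemma \<open>wiener_field_dyadic_incr_bound\<close> with \<open>c = 2 powr \<kappa>\<close>, for which \<open>4 < c ^ 4\<close> amounts to \<open>1/2 < \<kappa>\<close>, feeds the chaining argument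
on each rectangle \<open>[0, 2 ^ m] \<times> [0, 2 ^ n]\<close>, and a given point is treated on such a rectangle of
comparable size (\<open>exists_dyadic_bracket\<close>).\<close>

lemma wiener_field_growth:
  assumes M: "prob_space M" and W: "standard_wiener_field M W" and \<kappa>: "1/2 < \<kappa>"
  shows "AE \<omega> in M. \<exists>C\<ge>0. \<forall>x\<ge>0. \<forall>y\<ge>0. \<bar>W (x, y) \<omega>\<bar> \<le> C * (1 + x) powr \<kappa> * (1 + y) powr \<kappa>"
proof -
  define c where "c = 2 powr \<kappa>"
  have c: "0 < c" "4 < c ^ 4"
  proof -
    have "(2::real) powr 2 < 2 powr (4 * \<kappa>)" using \<kappa> by (intro powr_less_mono) auto
    then show "0 < c" "4 < c ^ 4" by (simp_all add: c_def powr_power)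
  qed
  \<comment> \<open>Any ratio \<open>r < 1\<close> with \<open>1 < 2 * r ^ 4\<close> serves; \<open>9/10\<close> gives \<open>r ^ 4 = 0.6561\<close>.\<close>
  have "AE \<omega> in M. \<exists>C\<ge>0. \<forall>m n k l. \<forall>i<2^k. \<forall>j<2^l.
    \<bar>dyadic_rect_incr (\<lambda>p. W p \<omega>) m n k l i j\<bar> \<le> C * c ^ m * c ^ n * (9/10) ^ k * (9/10) ^ l"
    using c by (intro wiener_field_dyadic_incr_bound[OF M W]) (auto simp: power_divide)
  moreover have "AE \<omega> in M. continuous_on ({0..} \<times> {0..}) (\<lambda>p. W p \<omega>)"
    using W by (simp add: standard_wiener_field_def centred_continuous_gauss_field_def continuous_paths_as_def)
  moreover note wiener_field_axes_zero[OF M W]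
  ultimately show ?thesis
  proof eventually_elim
    case (elim \<omega>)
    then obtain C where C: "C \<ge> 0" and incr: "\<And>m n k l i j. i < 2 ^ k \<Longrightarrow> j < 2 ^ l \<Longrightarrow>
      \<bar>dyadic_rect_incr (\<lambda>p. W p \<omega>) m n k l i j\<bar> \<le> C * c ^ m * c ^ n * (9/10) ^ k * (9/10) ^ l" by blast
    have "\<bar>W (x, y) \<omega>\<bar> \<le> 100 * C * (2 powr \<kappa>) * 2 powr \<kappa> * (1 + x) powr \<kappa> * (1 + y) powr \<kappa>" if xy: "0 \<le> x" "0 \<le> y" for x y
    proof -
      obtain m where m: "x \<le> 2 ^ m" "2 ^ m \<le> 2 * (1 + x)" using exists_dyadic_bracket xy(1) .
      obtain n where n: "y \<le> 2 ^ n" "2 ^ n \<le> 2 * (1 + y)" using exists_dyadic_bracket xy(2) .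
      have cpow: "c ^ m \<le> 2 powr \<kappa> * (1 + x) powr \<kappa>" if "0 \<le> x" "2 ^ m \<le> 2 * (1 + x)" for x and m :: nat
      proof -
        have "c ^ m = (2 ^ m) powr \<kappa>" by (simp add: c_def powr_powr mult.commute flip: powr_realpow)
        also have "\<dots> \<le> (2 * (1 + x)) powr \<kappa>" using that \<kappa> by (intro powr_mono2) auto
        also have "\<dots> = 2 powr \<kappa> * (1 + x) powr \<kappa>" by (rule powr_mult)
        finally show ?thesis .
      qed
      have "\<bar>W (x, y) \<omega>\<bar> \<le> C * c ^ m * c ^ n / (1 - 9/10) / (1 - 9/10)"
      proof (rule dyadic_chaining_rect[where w = "\<lambda>p. W p \<omega>" and L = "2 ^ m" and L' = "2 ^ n"])
        show "continuous_on ({0..2 ^ m} \<times> {0..2 ^ n}) (\<lambda>p. W p \<omega>)"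
          using elim(2) by (rule continuous_on_subset) auto
      qed (use incr[unfolded dyadic_rect_incr_def] C c elim(3) xy m n in auto)
      also have "\<dots> = 100 * C * c ^ m * c ^ n" by simp
      also have "\<dots> \<le> 100 * C * (2 powr \<kappa> * (1 + x) powr \<kappa>) * (2 powr \<kappa> * (1 + y) powr \<kappa>)"
        using C c cpow[OF xy(1) m(2)] cpow[OF xy(2) n(2)] by (intro mult_mono mult_nonneg_nonneg) auto
      finally show ?thesis by (simp add: mult_ac)
    qed
    then show ?case
      using C by (intro exI[of _ "100 * C * (2 powr \<kappa>) * 2 powr \<kappa>"]) auto
  qed
qed

section \<open>Clock and taper of the scaled bridge\<close>

text \<open>This is \<open>sqrt (g s / f s)\<close>, see \<open>sqrt_g_eq_taper\<close>: the deterministic factor that remains once the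
normalisation of the Ornstein-Uhlenbeck field is cancelled. In contrast to the quotient it is
also meaningful at \<open>0\<close> and \<open>S\<close>.\<close>

definition taper :: "real \<Rightarrow> real \<Rightarrow> real \<Rightarrow> real" where
  "taper \<alpha> S s = ((S - s) / S) powr \<alpha>"

lemma f_time_0 [simp]: "S > 0 \<Longrightarrow> f_time \<alpha> S 0 = 0"
  by (simp add: f_time_def)

lemma f_time_strict_mono:
  assumes "0 < S" "s < t" "t < S"
  shows "f_time \<alpha> S s < f_time \<alpha> S t"
proof (cases "\<alpha> = 1/2")
  case True
  have "S / (S - s) < S / (S - t)" using assms by (intro divide_strict_left_mono) auto
  then show ?thesis using True assms by (simp add: f_time_def)
next
  case False
  have "(S powr (1 - 2 * \<alpha>) - (S - s) powr (1 - 2 * \<alpha>)) / (1 - 2 * \<alpha>) <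
        (S powr (1 - 2 * \<alpha>) - (S - t) powr (1 - 2 * \<alpha>)) / (1 - 2 * \<alpha>)"
  proof (cases "\<alpha> < 1/2")
    case True
    then have "(S - t) powr (1 - 2 * \<alpha>) < (S - s) powr (1 - 2 * \<alpha>)"
      using assms by (intro powr_less_mono2) auto
    then show ?thesis using True by (intro divide_strict_right_mono) auto
  next
    case ge: False
    then have "(S - s) powr (1 - 2 * \<alpha>) < (S - t) powr (1 - 2 * \<alpha>)"
      using assms False by (intro powr_less_mono2_neg) auto
    then show ?thesis using ge False by (intro divide_strict_right_mono_neg) auto
  qed
  from mult_strict_left_mono[OF this, of "S powr (2 * \<alpha>)"] show ?thesis
    using False assms by (simp add: f_time_def)
qed

lemma f_time_pos: "0 < s \<Longrightarrow> s < S \<Longrightarrow> 0 < f_time \<alpha> S s"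
  using f_time_strict_mono[of S 0 s \<alpha>] by simp

lemma f_time_nonneg: "0 \<le> s \<Longrightarrow> s < S \<Longrightarrow> 0 \<le> f_time \<alpha> S s"
  using f_time_pos[of s S \<alpha>] by (cases "s = 0") auto

lemma f_time_min:
  assumes "0 < S" "s < S" "t < S"
  shows "min (f_time \<alpha> S s) (f_time \<alpha> S t) = f_time \<alpha> S (min s t)"
  using f_time_strict_mono[of S s t \<alpha>] f_time_strict_mono[of S t s \<alpha>] assms
  by (cases s t rule: linorder_cases) auto

lemma sqrt_g_eq_taper:
  assumes "0 < s" "s < S"
  shows "sqrt_g \<alpha> S s = taper \<alpha> S s * sqrt (f_time \<alpha> S s)"
proof (cases "\<alpha> = 1/2")
  case True
  have "taper \<alpha> S s = sqrt ((S - s) / S)"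
    using assms unfolding taper_def True by (simp add: powr_half_sqrt)
  then show ?thesis using assms unfolding True
    by (simp add: sqrt_g_def f_time_def flip: real_sqrt_mult)
next
  case False
  have "sqrt (S powr (2 * \<alpha>)) = S powr \<alpha>"
    using assms by (simp flip: powr_half_sqrt add: powr_powr)
  then have "sqrt (f_time \<alpha> S s) =
      S powr \<alpha> * sqrt ((S powr (1 - 2 * \<alpha>) - (S - s) powr (1 - 2 * \<alpha>)) / (1 - 2 * \<alpha>))"
    using False by (simp add: f_time_def real_sqrt_mult real_sqrt_divide)
  then show ?thesis using False assms
    by (simp add: sqrt_g_def taper_def powr_divide)
qed

lemma sqrt_g_times_exp:
  assumes "0 < s" "s < S"
  shows "sqrt_g \<alpha> S s * exp (- ln (f_time \<alpha> S s) / 2) = taper \<alpha> S s"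
proof -
  have f: "0 < f_time \<alpha> S s" using assms by (rule f_time_pos)
  then have "exp (ln (f_time \<alpha> S s) / 2) = sqrt (f_time \<alpha> S s)"
    by (simp add: powr_def flip: powr_half_sqrt)
  then have "exp (- ln (f_time \<alpha> S s) / 2) = 1 / sqrt (f_time \<alpha> S s)"
    by (simp add: exp_minus inverse_eq_divide)
  then show ?thesis using f sqrt_g_eq_taper[OF assms] by simp
qed

text \<open>The bridge covariance is that of a tapered Brownian motion run with the clock \<^const>\<open>f_time\<close>:
as the clock is increasing, the last factor is the minimum of the two clock values (\<open>f_time_min\<close>).\<close>

lemma bridge_cov_eq_taper:
  assumes "0 < S" "0 \<le> s" "s < S" "0 \<le> t" "t < S"
  shows "bridge_cov \<alpha> S s t = taper \<alpha> S s * taper \<alpha> S t * f_time \<alpha> S (min s t)"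
proof (cases "\<alpha> = 1/2")
  case True
  have "sqrt ((S - s) * (S - t)) = taper \<alpha> S s * taper \<alpha> S t * S"
    using assms unfolding taper_def True
    by (simp add: powr_half_sqrt real_sqrt_divide real_sqrt_mult)
  then show ?thesis using assms unfolding True by (simp add: bridge_cov_def f_time_def)
next
  case False
  have "S powr (2 * \<alpha>) = S powr \<alpha> * S powr \<alpha>" using assms by (simp flip: powr_add)
  then show ?thesis using False assms
    by (simp add: bridge_cov_def f_time_def taper_def powr_divide)
qed

lemma bridge_cov_boundary:
  assumes "0 < S" "s \<in> {0..S}" "t \<in> {0..S}" "s \<in> {0, S} \<or> t \<in> {0, S}"
  shows "bridge_cov \<alpha> S s t = 0"
  using assms by (auto simp: bridge_cov_def)

lemma continuous_on_f_time: "continuous_on {0..<S} (f_time \<alpha> S)"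
  unfolding f_time_def by (cases "\<alpha> = 1/2") (auto intro!: continuous_intros)

lemma continuous_on_taper: "0 < \<alpha> \<Longrightarrow> 0 < S \<Longrightarrow> continuous_on {0..S} (taper \<alpha> S)"
  unfolding taper_def by (intro continuous_on_powr' continuous_intros) auto

text \<open>The taper beats the growth of the Wiener field at \<open>S\<close>. With \<open>u = S - s\<close>, the clock stays bounded for
\<open>\<alpha> < 1/2\<close>, grows like \<open>ln (1 / u)\<close> for \<open>\<alpha> = 1/2\<close>, and like \<open>u powr (1 - 2 * \<alpha>)\<close> for \<open>\<alpha> > 1/2\<close>. In the last case
the product is of order \<open>u powr (\<alpha> - \<kappa> * (2 * \<alpha> - 1))\<close>, whose exponent is positive by assumption.\<close>

lemma taper_f_time_tendsto_0:
  assumes S: "0 < S" and \<alpha>: "0 < \<alpha>" and \<kappa>: "0 < \<kappa>" "\<kappa> * (2 * \<alpha> - 1) < \<alpha>"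
  shows "((\<lambda>s. taper \<alpha> S s * (1 + f_time \<alpha> S s) powr \<kappa>) \<longlongrightarrow> 0) (at_left S)"
proof -
  have left: "filterlim (\<lambda>s. S - s) (at_right 0) (at_left S)" by real_asymp
  have "((\<lambda>u. taper \<alpha> S (S - u) * (1 + f_time \<alpha> S (S - u)) powr \<kappa>) \<longlongrightarrow> 0) (at_right 0)"
  proof (cases "\<alpha> = 1/2")
    case True
    have "((\<lambda>u. (u / S) powr (1/2) * (1 + S * ln (S / u)) powr \<kappa>) \<longlongrightarrow> 0) (at_right 0)"
      using S \<kappa> by real_asymp
    then show ?thesis unfolding True by (simp add: taper_def f_time_def)
  next
    case False
    define \<gamma> where "\<gamma> = 1 - 2 * \<alpha>"
    define K where "K = S powr (2 * \<alpha>) / \<gamma>"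
    define E where "E = S powr \<gamma>"
    have "((\<lambda>u. (u / S) powr \<alpha> * (1 + K * (E - u powr \<gamma>)) powr \<kappa>) \<longlongrightarrow> 0) (at_right 0)"
    proof (cases "\<alpha> < 1/2")
      case True
      then have "K > 0" "E > 0" "\<gamma> > 0" using S by (auto simp: K_def E_def \<gamma>_def)
      moreover from this have "1 + K * E > 0" by (simp add: add_pos_pos)
      \<comment> \<open>The base \<open>1 + K * (E - u powr \<gamma>)\<close> tends to \<open>1 + K * E\<close>, whose sign decides the expansion.\<close>
      ultimately show ?thesis using S \<alpha> \<kappa>(1) by real_asymp
    next
      case ge: False
      with False have "K < 0" "\<gamma> < 0" using S by (auto simp: K_def \<gamma>_def divide_neg_pos divide_pos_neg)
      moreover have "\<alpha> + \<gamma> * \<kappa> > 0" using \<kappa> by (simp add: \<gamma>_def algebra_simps)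
      ultimately show ?thesis using S \<alpha> \<kappa>(1) by real_asymp
    qed
    then show ?thesis using False by (simp add: taper_def f_time_def K_def E_def \<gamma>_def)
  qed
  from filterlim_compose[OF this left] show ?thesis by simp
qed

text \<open>Together with the growth of the Wiener field, the product of two envelopes dominates the bridge. At
\<open>S\<close>, where \<^const>\<open>f_time\<close> has a default value if \<open>\<alpha> \<ge> 1/2\<close>, the first factor makes it \<open>0\<close>, which is also its limit.\<close>

definition envelope :: "real \<Rightarrow> real \<Rightarrow> real \<Rightarrow> real \<Rightarrow> real" where
  "envelope \<kappa> \<alpha> S s = taper \<alpha> S s * (1 + f_time \<alpha> S s) powr \<kappa>"

lemma envelope_endpoint [simp]: "envelope \<kappa> \<alpha> S S = 0"
  by (simp add: envelope_def taper_def)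

lemma continuous_on_envelope:
  assumes S: "0 < S" and \<alpha>: "0 < \<alpha>" and \<kappa>: "0 < \<kappa>" "\<kappa> * (2 * \<alpha> - 1) < \<alpha>"
  shows "continuous_on {0..S} (envelope \<kappa> \<alpha> S)"
  unfolding continuous_on_eq_continuous_within
proof
  fix s assume s: "s \<in> {0..S}"
  show "continuous (at s within {0..S}) (envelope \<kappa> \<alpha> S)"
  proof (cases "s = S")
    case True
    have "(envelope \<kappa> \<alpha> S \<longlongrightarrow> 0) (at_left S)"
      unfolding envelope_def using taper_f_time_tendsto_0[OF assms] .
    then show ?thesis
      using True S by (simp add: continuous_within at_within_Icc_at_left)
  next
    case False
    have "continuous_on {0..<S} (envelope \<kappa> \<alpha> S)"
      unfolding envelope_def
    proof (intro continuous_on_mult continuous_on_powr' continuous_on_add continuous_on_const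
        continuous_on_f_time ballI)
      show "continuous_on {0..<S} (taper \<alpha> S)"
        using continuous_on_taper[OF \<alpha> S] by (rule continuous_on_subset) auto
      fix s assume "s \<in> {0..<S}"
      then have "0 \<le> f_time \<alpha> S s" by (simp add: f_time_nonneg)
      then show "0 \<le> 1 + f_time \<alpha> S s \<and> (1 + f_time \<alpha> S s = 0 \<longrightarrow> 0 < \<kappa>)" by simp
    qed
    then have "continuous (at s within {0..<S}) (envelope \<kappa> \<alpha> S)"
      using s False by (simp add: continuous_on_eq_continuous_within)
    moreover have "at s within {0..S} = at s within {0..<S}"
      using s False by (intro at_within_nhd[of _ "{..<S}"]) auto
    ultimately show ?thesis by (simp add: continuous_within)
  qed
qed

section \<open>Path continuity of tapered fields\<close>

text \<open>The pathwise core. On \<open>[0, S) \<times> [0, T)\<close> the function is a composition of continuous functions; the edges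
\<open>s = 0\<close> and \<open>t = 0\<close> are included, because the clock is \<open>0\<close> there and \<open>w\<close> vanishes on the axes. On the
other two edges, where a clock may become infinite, the function is squeezed by a product of envelopes that
is continuous on the closed rectangle and vanishes there.\<close>

lemma continuous_on_tapered_sheet:
  fixes w u :: "real \<times> real \<Rightarrow> real"
  assumes w: "continuous_on ({0..} \<times> {0..}) w"
    and w0: "\<And>x. 0 \<le> x \<Longrightarrow> w (x, 0) = 0 \<and> w (0, x) = 0"
    and growth: "\<And>x y. 0 \<le> x \<Longrightarrow> 0 \<le> y \<Longrightarrow> \<bar>w (x, y)\<bar> \<le> C * (1 + x) powr \<kappa> * (1 + y) powr \<kappa>"
    and pos: "0 < S" "0 < T" "0 < \<alpha>" "0 < \<beta>" "0 < \<kappa>"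
    and \<kappa>: "\<kappa> * (2 * \<alpha> - 1) < \<alpha>" "\<kappa> * (2 * \<beta> - 1) < \<beta>"
    and u: "\<And>s t. 0 < s \<Longrightarrow> s < S \<Longrightarrow> 0 < t \<Longrightarrow> t < T \<Longrightarrow>
      u (s, t) = taper \<alpha> S s * taper \<beta> T t * w (f_time \<alpha> S s, f_time \<beta> T t)"
    and u0: "\<And>s t. s \<in> {0..S} \<Longrightarrow> t \<in> {0..T} \<Longrightarrow> s \<in> {0, S} \<or> t \<in> {0, T} \<Longrightarrow> u (s, t) = 0"
  shows "continuous_on ({0..S} \<times> {0..T}) u"
proof -
  let ?D = "{0..S} \<times> {0..T}" and ?E = "{0..<S} \<times> {0..<T}"
  let ?v = "\<lambda>p. taper \<alpha> S (fst p) * taper \<beta> T (snd p) * w (f_time \<alpha> S (fst p), f_time \<beta> T (snd p))"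
  have v: "u p = ?v p" if "p \<in> ?E" for p
  proof -
    obtain s t where p: "p = (s, t)" by fastforce
    with that have st: "0 \<le> s" "s < S" "0 \<le> t" "t < T" by auto
    show ?thesis
    proof (cases "s = 0 \<or> t = 0")
      case True
      then show ?thesis using st u0[of s t] w0 pos by (auto simp: p f_time_nonneg)
    next
      case False
      then show ?thesis using st u[of s t] by (simp add: p)
    qed
  qed
  have "continuous_on ?E ?v"
  proof (intro continuous_on_mult)
    show "continuous_on ?E (\<lambda>p. taper \<alpha> S (fst p))"
      by (rule continuous_on_compose2[OF continuous_on_taper]) (use pos in \<open>auto intro: continuous_intros\<close>)
    show "continuous_on ?E (\<lambda>p. taper \<beta> T (snd p))"
      by (rule continuous_on_compose2[OF continuous_on_taper]) (use pos in \<open>auto intro: continuous_intros\<close>)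
    have "continuous_on ?E (\<lambda>p. f_time \<alpha> S (fst p))" "continuous_on ?E (\<lambda>p. f_time \<beta> T (snd p))"
      by (rule continuous_on_compose2[OF continuous_on_f_time]; auto intro: continuous_intros)+
    then show "continuous_on ?E (\<lambda>p. w (f_time \<alpha> S (fst p), f_time \<beta> T (snd p)))"
      by (intro continuous_on_compose2[OF w] continuous_on_Pair) (auto simp: f_time_nonneg)
  qed
  then have contE: "continuous_on ?E u"
    by (rule continuous_on_eq) (simp add: v)
  define b where "b p = C * envelope \<kappa> \<alpha> S (fst p) * envelope \<kappa> \<beta> T (snd p)" for p
  have bound: "\<bar>u p\<bar> \<le> b p" if "p \<in> ?D" for p
  proof (cases "p \<in> ?E")
    case True
    obtain s t where p: "p = (s, t)" by fastforce
    with True have st: "0 \<le> s" "s < S" "0 \<le> t" "t < T" by auto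
    have ge: "0 \<le> taper \<alpha> S s * taper \<beta> T t" by (simp add: taper_def)
    have "\<bar>u p\<bar> = taper \<alpha> S s * taper \<beta> T t * \<bar>w (f_time \<alpha> S s, f_time \<beta> T t)\<bar>"
      using v[OF True] by (simp add: p abs_mult taper_def)
    also have "\<dots> \<le> taper \<alpha> S s * taper \<beta> T t *
        (C * (1 + f_time \<alpha> S s) powr \<kappa> * (1 + f_time \<beta> T t) powr \<kappa>)"
      using st by (intro mult_left_mono growth ge f_time_nonneg)
    also have "\<dots> = b p" using st by (simp add: b_def p envelope_def mult_ac)
    finally show ?thesis .
  next
    case False
    then have "fst p = S \<or> snd p = T" using that by auto
    then show ?thesis using u0[of "fst p" "snd p"] that by (auto simp: b_def)
  qed
  have contb: "continuous_on ?D b"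
    unfolding b_def using pos \<kappa>
    by (intro continuous_on_mult continuous_on_const
        continuous_on_compose2[OF continuous_on_envelope[of S \<alpha> \<kappa>] continuous_on_fst[OF continuous_on_id]]
        continuous_on_compose2[OF continuous_on_envelope[of T \<beta> \<kappa>] continuous_on_snd[OF continuous_on_id]])
      auto
  show ?thesis
    unfolding continuous_on_eq_continuous_within
  proof
    fix p assume p: "p \<in> ?D"
    show "continuous (at p within ?D) u"
    proof (cases "p \<in> ?E")
      case True
      then have "continuous (at p within ?E) u"
        using contE unfolding continuous_on_eq_continuous_within by blast
      moreover have "at p within ?D = at p within ?E"
        using True by (intro at_within_nhd[of _ "{..<S} \<times> {..<T}"]) (auto intro: open_Times)
      ultimately show ?thesis by (simp add: continuous_within)
    next
      case False
      then have far: "fst p = S \<or> snd p = T" using p by auto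
      then have "b p = 0" "u p = 0"
        using u0[of "fst p" "snd p"] p by (auto simp: b_def)
      then have "(b \<longlongrightarrow> 0) (at p within ?D)"
        using contb p unfolding continuous_on_def by metis
      then have "(u \<longlongrightarrow> 0) (at p within ?D)"
        by (rule Lim_null_comparison[rotated]) (auto simp: eventually_at_filter bound)
      then show ?thesis using \<open>u p = 0\<close> by (simp add: continuous_within)
    qed
  qed
qed

section \<open>The Ornstein-Uhlenbeck field and the tied-down bridge\<close>

text \<open>The time change \<open>exp\<close> turns Brownian motion into the Ornstein-Uhlenbeck process; in each coordinate the
covariance identity is this one.\<close>

lemma exp_min_eq: "exp (- s / 2) * exp (- t / 2) * min (exp s) (exp t) = exp (- (1/2) * \<bar>t - s\<bar>)"
  for s t :: real
  by (auto simp: min_def abs_if field_simps simp flip: exp_add)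

lemma wiener_field_imp_OU_field:
  assumes M: "prob_space M" and W: "standard_wiener_field M W"
    and X: "\<And>s t \<omega>. X (s, t) \<omega> = exp (- s / 2 - t / 2) * W (exp s, exp t) \<omega>"
  shows "stationary_OU_field M X"
  unfolding stationary_OU_field_def
proof (rule centred_continuous_gauss_field_rescale[OF M W[unfolded standard_wiener_field_def]])
  let ?\<phi> = "\<lambda>p::real \<times> real. (exp (fst p), exp (snd p))"
    and ?a = "\<lambda>p::real \<times> real. exp (- fst p / 2 - snd p / 2)"
  show "?\<phi> p \<in> {0..} \<times> {0..}" for p by simp
  show X': "X p \<omega> = ?a p * W (?\<phi> p) \<omega>" for p \<omega>
    using X[of "fst p" "snd p"] by simp
  show "(case p of (s1, t1) \<Rightarrow> \<lambda>(s2, t2). exp (- (1/2) * \<bar>s2 - s1\<bar> - (1/2) * \<bar>t2 - t1\<bar>)) q =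
    ?a p * ?a q * (case ?\<phi> p of (s1, t1) \<Rightarrow> \<lambda>(s2, t2). min s1 s2 * min t1 t2) (?\<phi> q)" for p q
  proof -
    have "exp (- (1/2) * \<bar>s2 - s1\<bar> - (1/2) * \<bar>t2 - t1\<bar>) =
        exp (- s1 / 2 - t1 / 2) * exp (- s2 / 2 - t2 / 2) * (min (exp s1) (exp s2) * min (exp t1) (exp t2))"
      for s1 s2 t1 t2 :: real
    proof -
      have "exp (- (1/2) * \<bar>s2 - s1\<bar> - (1/2) * \<bar>t2 - t1\<bar>) =
          exp (- (1/2) * \<bar>s2 - s1\<bar>) * exp (- (1/2) * \<bar>t2 - t1\<bar>)"
        by (simp flip: exp_add)
      also have "\<dots> = (exp (- s1 / 2) * exp (- t1 / 2)) * (exp (- s2 / 2) * exp (- t2 / 2)) *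
          (min (exp s1) (exp s2) * min (exp t1) (exp t2))"
        unfolding exp_min_eq[of s1 s2, symmetric] exp_min_eq[of t1 t2, symmetric]
        by (simp only: mult_ac)
      finally show ?thesis by (simp flip: exp_add)
    qed
    then show ?thesis by (simp add: case_prod_unfold)
  qed
  have "AE \<omega> in M. continuous_on ({0..} \<times> {0..}) (\<lambda>p. W p \<omega>)"
    using W by (simp add: standard_wiener_field_def centred_continuous_gauss_field_def
        continuous_paths_as_def)
  then show "continuous_paths_as M UNIV X"
    unfolding continuous_paths_as_def
  proof eventually_elim
    case (elim \<omega>)
    show ?case unfolding X'
      by (intro continuous_intros continuous_on_compose2[OF elim]) auto
  qed
qed

lemma wiener_field_imp_tied_down_bridge:
  assumes M: "prob_space M" and W: "standard_wiener_field M W"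
    and pos: "0 < S" "0 < T" "0 < \<alpha>" "0 < \<beta>"
    and U: "\<And>s t \<omega>. 0 < s \<Longrightarrow> s < S \<Longrightarrow> 0 < t \<Longrightarrow> t < T \<Longrightarrow>
      U (s, t) \<omega> = taper \<alpha> S s * taper \<beta> T t * W (f_time \<alpha> S s, f_time \<beta> T t) \<omega>"
    and U0: "\<And>s t \<omega>. s \<in> {0..S} \<Longrightarrow> t \<in> {0..T} \<Longrightarrow> s \<in> {0, S} \<or> t \<in> {0, T} \<Longrightarrow> U (s, t) \<omega> = 0"
  shows "tied_down_scaled_wiener_bridge M S T \<alpha> \<beta> U"
  unfolding tied_down_scaled_wiener_bridge_def
proof (rule centred_continuous_gauss_field_rescale[OF M W[unfolded standard_wiener_field_def]])
  let ?I = "{0<..<S} \<times> {0<..<T}" and ?D = "{0..S} \<times> {0..T}"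
  \<comment> \<open>On the boundary the factor \<open>0\<close> reproduces the value of the bridge 
    exactly, and not only almost surely; \<open>(0, 0)\<close> is a default point.\<close>
  let ?\<phi> = "\<lambda>p. if p \<in> ?I then (f_time \<alpha> S (fst p), f_time \<beta> T (snd p)) else (0, 0)"
    and ?a = "\<lambda>p. if p \<in> ?I then taper \<alpha> S (fst p) * taper \<beta> T (snd p) else 0"
  show "?\<phi> p \<in> {0..} \<times> {0..}" for p
    by (auto simp: f_time_nonneg)
  show "U p \<omega> = ?a p * W (?\<phi> p) \<omega>" if "p \<in> ?D" for p \<omega>
  proof (cases "p \<in> ?I")
    case True
    then show ?thesis using U[of "fst p" "snd p"] by auto
  next
    case False
    with that have "fst p \<in> {0, S} \<or> snd p \<in> {0, T}" by force
    then show ?thesis using False that U0[of "fst p" "snd p"] by auto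
  qed
  show "(case p of (s1, t1) \<Rightarrow> \<lambda>(s2, t2). bridge_cov \<alpha> S s1 s2 * bridge_cov \<beta> T t1 t2) q =
    ?a p * ?a q * (case ?\<phi> p of (s1, t1) \<Rightarrow> \<lambda>(s2, t2). min s1 s2 * min t1 t2) (?\<phi> q)"
    if "p \<in> ?D" "q \<in> ?D" for p q
  proof -
    obtain s1 t1 s2 t2 where pq: "p = (s1, t1)" "q = (s2, t2)" by fastforce
    show ?thesis
    proof (cases "p \<in> ?I \<and> q \<in> ?I")
      case True
      then show ?thesis using pq pos
        by (simp add: bridge_cov_eq_taper f_time_min mult_ac)
    next
      case False
      then have "(s1 \<in> {0, S} \<or> s2 \<in> {0, S}) \<or> (t1 \<in> {0, T} \<or> t2 \<in> {0, T})"
        using that by (auto simp: pq)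
      then have "bridge_cov \<alpha> S s1 s2 = 0 \<or> bridge_cov \<beta> T t1 t2 = 0"
        using that pos bridge_cov_boundary[of S s1 s2 \<alpha>] bridge_cov_boundary[of T t1 t2 \<beta>]
        unfolding pq mem_Times_iff fst_conv snd_conv by blast
      then show ?thesis using False by (auto simp: pq)
    qed
  qed
  \<comment> \<open>For \<open>\<kappa> = 1/2 + d\<close> the condition \<open>\<kappa> * (2 * \<alpha> - 1) < \<alpha>\<close> says
    \<open>d * (2 * \<alpha> - 1) < 1/2\<close>, and \<open>d = 1 / (4 * (\<alpha> + \<beta>))\<close> satisfies it for \<open>\<alpha>\<close> and \<open>\<beta>\<close> at once.\<close>
  define \<kappa> where "\<kappa> = 1/2 + 1 / (4 * (\<alpha> + \<beta>))"
  have \<kappa>: "1/2 < \<kappa>" "\<kappa> * (2 * \<alpha> - 1) < \<alpha>" "\<kappa> * (2 * \<beta> - 1) < \<beta>"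
    using pos by (auto simp: \<kappa>_def field_simps)
  have "AE \<omega> in M. continuous_on ({0..} \<times> {0..}) (\<lambda>p. W p \<omega>)"
    using W by (simp add: standard_wiener_field_def centred_continuous_gauss_field_def
        continuous_paths_as_def)
  with wiener_field_axes_zero[OF M W] wiener_field_growth[OF M W \<kappa>(1)]
  show "continuous_paths_as M ?D U"
    unfolding continuous_paths_as_def
  proof eventually_elim
    case (elim \<omega>)
    then obtain C where "\<And>x y. 0 \<le> x \<Longrightarrow> 0 \<le> y \<Longrightarrow>
      \<bar>W (x, y) \<omega>\<bar> \<le> C * (1 + x) powr \<kappa> * (1 + y) powr \<kappa>" by blast
    then show ?case
      using elim pos \<kappa> U U0
      by (intro continuous_on_tapered_sheet[of "\<lambda>p. W p \<omega>" C \<kappa> S T \<alpha> \<beta>]) auto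
  qed
qed

theorem proposition3p1:
  fixes M :: "'a measure" and W X U :: "real \<times> real \<Rightarrow> 'a \<Rightarrow> real"
    and S T \<alpha> \<beta> :: real
  assumes "prob_space M"
    and "standard_wiener_field M W"
    and "\<And>s t \<omega>. X (s, t) \<omega> = exp (- s / 2 - t / 2) * W (exp s, exp t) \<omega>"
    and "S > 0" and "T > 0" and "\<alpha> > 0" and "\<beta> > 0"
    and "\<And>s t \<omega>. (s, t) \<in> {0<..<S} \<times> {0<..<T} \<Longrightarrow>
           U (s, t) \<omega> = sqrt_g \<alpha> S s * sqrt_g \<beta> T t * X (ln (f_time \<alpha> S s), ln (f_time \<beta> T t)) \<omega>"
    and "\<And>s t \<omega>. (s, t) \<in> {0..S} \<times> {0..T} \<Longrightarrow> s \<in> {0, S} \<or> t \<in> {0, T} \<Longrightarrow> U (s, t) \<omega> = 0"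
  shows "stationary_OU_field M X \<and> tied_down_scaled_wiener_bridge M S T \<alpha> \<beta> U"
proof
  show "stationary_OU_field M X"
    using assms(1-3) by (rule wiener_field_imp_OU_field)
  show "tied_down_scaled_wiener_bridge M S T \<alpha> \<beta> U"
  proof (rule wiener_field_imp_tied_down_bridge[OF assms(1,2,4-7)])
    fix s t \<omega> assume st: "0 < s" "s < S" "0 < t" "t < T"
    have "U (s, t) \<omega> = sqrt_g \<alpha> S s * sqrt_g \<beta> T t *
        (exp (- ln (f_time \<alpha> S s) / 2 - ln (f_time \<beta> T t) / 2) * W (f_time \<alpha> S s, f_time \<beta> T t) \<omega>)"
      using st assms(3,8) by (simp add: f_time_pos)
    also have "exp (- ln (f_time \<alpha> S s) / 2 - ln (f_time \<beta> T t) / 2) =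
        exp (- ln (f_time \<alpha> S s) / 2) * exp (- ln (f_time \<beta> T t) / 2)"
      by (simp flip: exp_add)
    also have "sqrt_g \<alpha> S s * sqrt_g \<beta> T t *
        (exp (- ln (f_time \<alpha> S s) / 2) * exp (- ln (f_time \<beta> T t) / 2) * W (f_time \<alpha> S s, f_time \<beta> T t) \<omega>) =
        (sqrt_g \<alpha> S s * exp (- ln (f_time \<alpha> S s) / 2)) * (sqrt_g \<beta> T t * exp (- ln (f_time \<beta> T t) / 2)) *
        W (f_time \<alpha> S s, f_time \<beta> T t) \<omega>" by (simp only: mult_ac)
    also have "\<dots> = taper \<alpha> S s * taper \<beta> T t * W (f_time \<alpha> S s, f_time \<beta> T t) \<omega>"
      using st by (simp only: sqrt_g_times_exp)
    finally show "U (s, t) \<omega> = taper \<alpha> S s * taper \<beta> T t * W (f_time \<alpha> S s, f_time \<beta> T t) \<omega>" .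
  next
    fix s t \<omega> assume "s \<in> {0..S}" "t \<in> {0..T}" "s \<in> {0, S} \<or> t \<in> {0, T}"
    then show "U (s, t) \<omega> = 0" using assms(9) by blast
  qed
qed

end
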